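(* Let $R$ and $C$ be unital rings and $Z$ an injective cogenerator in the category of right $C$-modules. Let $U$ be an $R,C$-bimodule which is faithful as a left $R$-module and let $T$ be the trace ideal (in $R$) of $U$ as a left $R$-module. Suppose that $u\in Tu$ for each $u\in U^n$ and each $n\in\mathbb{N}$. (i) Then $R$ is dense in $B:=\mathrm{Biend}_R(U)$ in the sense that for each $b\in B$ and each finite subset $G\subseteq U$ there exists an $r\in R$ such that $ru=bu$ for all $u\in G$. (ii) Suppose that $C$ is contained in the center of $R$ and $cu=uc$ for all $u\in U$ and $c\in C$. If $U$ is torsionless and flat as an $R$-module and if $\mathrm{End}_C(Z)=C$, then $R$ is weakly dense in $\tilde{B}:=\mathrm{Biend}_R(U^* )$ in the sense that for each $s\in\tilde{B}$ and each finite subset $H$ of $U\times U^*$ there exists $r\in R$ such that $(\rho r)(u)=(\rho s)(u)$ for all $(u,\rho)\in H$.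
   Context: All rings and modules are unital. A right $C$-module $Z$ is a cogenerator if for every right $C$-module $W$ and $0\ne w\in W$ there is $f\in\mathrm{Hom}_C(W,Z)$ with $f(w)\ne0$. $U^*=\mathrm{Hom}_C(U,Z)$ is a right $R$-module via $(\rho r)(u)=\rho(ru)$. For a left or right $R$-module $X$, $\mathrm{Biend}_R(X)=\mathrm{End}_{\mathrm{End}_R(X)}(X)$, the ring of additive maps on $X$ commuting with all $R$-endomorphisms of $X$; on a left module biendomorphisms are written on the left, and on a right module such as $U^*$ on the right, so $\rho s$ denotes the image of $\rho$ under $s\in\mathrm{Biend}_R(U^* )$. The trace ideal $T$ of $U$ is the two-sided ideal of $R$ consisting of all finite sums of elements $f(u)$, $u\in U$, $f\in\mathrm{Hom}_R(U,R)$. For $u=(u_1,\dots,u_n)\in U^n$, $Tu=\{(tu_1,\dots,tu_n): t\in T\}$. $U$ is torsionless if for each $0\neq u\in U$ there is $f\in\mathrm{Hom}_R(U,R)$ with $f(u)\ne0$. $\mathrm{End}_C(Z)=C$ means that every $C$-endomorphism of $Z$ is multiplication by an element of $C$ (with $C$ commutative). *)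

theory Defs
  imports "HOL-Algebra.Ring" "HOL-Algebra.Free_Abelian_Groups"
begin

text \<open>
  Rings are not assumed commutative.  A module is given by an \<^locale>\<open>abelian_group\<close>, i.e. a
  \<^typ>\<open>'m ring\<close> record whose fields \<^const>\<open>monoid.mult\<close> and \<^const>\<open>monoid.one\<close> are ignored, together
  with a separate action function \<open>r \<mapsto> x \<mapsto> r x\<close> (left modules) or \<open>x \<mapsto> r \<mapsto> x r\<close> (right
  modules).  Keeping the actions apart lets one group carry a left and a right structure.
\<close>

locale left_module = R?: ring R + M?: abelian_group M
  for R :: "('r, 'p) ring_scheme" and M :: "('m, 'q) ring_scheme" and act :: "'r \<Rightarrow> 'm \<Rightarrow> 'm" +
  assumes act_closed: "\<lbrakk>r \<in> carrier R; x \<in> carrier M\<rbrakk> \<Longrightarrow> act r x \<in> carrier M"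
    and act_l_distr: "\<lbrakk>r \<in> carrier R; s \<in> carrier R; x \<in> carrier M\<rbrakk>
      \<Longrightarrow> act (r \<oplus>\<^bsub>R\<^esub> s) x = act r x \<oplus>\<^bsub>M\<^esub> act s x"
    and act_r_distr: "\<lbrakk>r \<in> carrier R; x \<in> carrier M; y \<in> carrier M\<rbrakk>
      \<Longrightarrow> act r (x \<oplus>\<^bsub>M\<^esub> y) = act r x \<oplus>\<^bsub>M\<^esub> act r y"
    and act_assoc: "\<lbrakk>r \<in> carrier R; s \<in> carrier R; x \<in> carrier M\<rbrakk>
      \<Longrightarrow> act (r \<otimes>\<^bsub>R\<^esub> s) x = act r (act s x)"
    and act_one: "x \<in> carrier M \<Longrightarrow> act \<one>\<^bsub>R\<^esub> x = x"

locale right_module = R?: ring R + M?: abelian_group M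
  for R :: "('r, 'p) ring_scheme" and M :: "('m, 'q) ring_scheme" and act :: "'m \<Rightarrow> 'r \<Rightarrow> 'm" +
  assumes act_closed: "\<lbrakk>r \<in> carrier R; x \<in> carrier M\<rbrakk> \<Longrightarrow> act x r \<in> carrier M"
    and act_r_distr: "\<lbrakk>r \<in> carrier R; s \<in> carrier R; x \<in> carrier M\<rbrakk>
      \<Longrightarrow> act x (r \<oplus>\<^bsub>R\<^esub> s) = act x r \<oplus>\<^bsub>M\<^esub> act x s"
    and act_l_distr: "\<lbrakk>r \<in> carrier R; x \<in> carrier M; y \<in> carrier M\<rbrakk>
      \<Longrightarrow> act (x \<oplus>\<^bsub>M\<^esub> y) r = act x r \<oplus>\<^bsub>M\<^esub> act y r"
    and act_assoc: "\<lbrakk>r \<in> carrier R; s \<in> carrier R; x \<in> carrier M\<rbrakk>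
      \<Longrightarrow> act x (r \<otimes>\<^bsub>R\<^esub> s) = act (act x r) s"
    and act_one: "x \<in> carrier M \<Longrightarrow> act x \<one>\<^bsub>R\<^esub> = x"

locale bimodule = left: left_module R U la + right: right_module C U ra
  for R :: "('r, 'p) ring_scheme" and C :: "('c, 'q) ring_scheme" and U :: "('u, 's) ring_scheme"
    and la :: "'r \<Rightarrow> 'u \<Rightarrow> 'u" and ra :: "'u \<Rightarrow> 'c \<Rightarrow> 'u" +
  assumes bi_assoc: "\<lbrakk>r \<in> carrier R; c \<in> carrier C; u \<in> carrier U\<rbrakk>
      \<Longrightarrow> la r (ra u c) = ra (la r u) c"

subsection \<open>Homomorphisms, endomorphisms, biendomorphisms\<close>

text \<open>
  Homomorphisms are extensional (\<^const>\<open>undefined\<close> outside the carrier), so that equality of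
  homomorphisms is equality of functions.  The scalars \<open>S\<close> are an arbitrary set, so that the same
  notion covers maps commuting with a ring and maps commuting with an endomorphism ring.
\<close>

definition lhom ::
  "'s set \<Rightarrow> ('m, 'p) ring_scheme \<Rightarrow> ('s \<Rightarrow> 'm \<Rightarrow> 'm)
    \<Rightarrow> ('n, 'q) ring_scheme \<Rightarrow> ('s \<Rightarrow> 'n \<Rightarrow> 'n) \<Rightarrow> ('m \<Rightarrow> 'n) set" where
  "lhom S M am N an = {f \<in> carrier M \<rightarrow>\<^sub>E carrier N.
     (\<forall>x\<in>carrier M. \<forall>y\<in>carrier M. f (x \<oplus>\<^bsub>M\<^esub> y) = f x \<oplus>\<^bsub>N\<^esub> f y) \<and>
     (\<forall>s\<in>S. \<forall>x\<in>carrier M. f (am s x) = an s (f x))}"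

definition rhom ::
  "'s set \<Rightarrow> ('m, 'p) ring_scheme \<Rightarrow> ('m \<Rightarrow> 's \<Rightarrow> 'm)
    \<Rightarrow> ('n, 'q) ring_scheme \<Rightarrow> ('n \<Rightarrow> 's \<Rightarrow> 'n) \<Rightarrow> ('m \<Rightarrow> 'n) set" where
  "rhom S M am N an = {f \<in> carrier M \<rightarrow>\<^sub>E carrier N.
     (\<forall>x\<in>carrier M. \<forall>y\<in>carrier M. f (x \<oplus>\<^bsub>M\<^esub> y) = f x \<oplus>\<^bsub>N\<^esub> f y) \<and>
     (\<forall>s\<in>S. \<forall>x\<in>carrier M. f (am x s) = an (f x) s)}"

text \<open>
  \<open>Biend_R(X) = End_{End_R(X)}(X)\<close>.  The endomorphism ring acts by evaluation.  As \<open>Biend\<close> is only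
  used through the values of its elements, writing biendomorphisms on the left or on the right makes
  no difference: \<open>s x\<close> below is the \<open>x s\<close> of a right module \<open>X\<close>.
\<close>

definition lbiend ::
  "('r, 'p) ring_scheme \<Rightarrow> ('m, 'q) ring_scheme \<Rightarrow> ('r \<Rightarrow> 'm \<Rightarrow> 'm) \<Rightarrow> ('m \<Rightarrow> 'm) set" where
  "lbiend R M act = lhom (lhom (carrier R) M act M act) M (\<lambda>\<phi> x. \<phi> x) M (\<lambda>\<phi> x. \<phi> x)"

definition rbiend ::
  "('r, 'p) ring_scheme \<Rightarrow> ('m, 'q) ring_scheme \<Rightarrow> ('m \<Rightarrow> 'r \<Rightarrow> 'm) \<Rightarrow> ('m \<Rightarrow> 'm) set" where
  "rbiend R M act = lhom (rhom (carrier R) M act M act) M (\<lambda>\<phi> x. \<phi> x) M (\<lambda>\<phi> x. \<phi> x)"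

subsection \<open>The dual \<open>U\<^sup>* = Hom_C(U, Z)\<close>\<close>

definition dual ::
  "('c, 'p) ring_scheme \<Rightarrow> ('u, 'q) ring_scheme \<Rightarrow> ('u \<Rightarrow> 'c \<Rightarrow> 'u)
    \<Rightarrow> ('z, 's) ring_scheme \<Rightarrow> ('z \<Rightarrow> 'c \<Rightarrow> 'z) \<Rightarrow> ('u \<Rightarrow> 'z) ring" where
  "dual C U ra Z za =
    \<lparr>carrier = rhom (carrier C) U ra Z za, monoid.mult = undefined, monoid.one = undefined,
     ring.zero = (\<lambda>u\<in>carrier U. \<zero>\<^bsub>Z\<^esub>), ring.add = (\<lambda>\<rho> \<sigma>. \<lambda>u\<in>carrier U. \<rho> u \<oplus>\<^bsub>Z\<^esub> \<sigma> u)\<rparr>"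

definition dual_act :: "('u, 'q) ring_scheme \<Rightarrow> ('r \<Rightarrow> 'u \<Rightarrow> 'u) \<Rightarrow> ('u \<Rightarrow> 'z) \<Rightarrow> 'r \<Rightarrow> ('u \<Rightarrow> 'z)" where
  "dual_act U la \<rho> r = (\<lambda>u\<in>carrier U. \<rho> (la r u))"

subsection \<open>Trace ideal, torsionless and faithful modules\<close>

definition trace_ideal ::
  "('r, 'p) ring_scheme \<Rightarrow> ('u, 'q) ring_scheme \<Rightarrow> ('r \<Rightarrow> 'u \<Rightarrow> 'u) \<Rightarrow> 'r set" where
  "trace_ideal R U la =
    {(\<Oplus>\<^bsub>R\<^esub>i\<in>{..<n}. f i (u i)) | (n::nat) f u.
       (\<forall>i<n. f i \<in> lhom (carrier R) U la R (\<lambda>r x. r \<otimes>\<^bsub>R\<^esub> x) \<and> u i \<in> carrier U)}"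

definition faithful ::
  "('r, 'p) ring_scheme \<Rightarrow> ('u, 'q) ring_scheme \<Rightarrow> ('r \<Rightarrow> 'u \<Rightarrow> 'u) \<Rightarrow> bool" where
  "faithful R U la \<longleftrightarrow>
    (\<forall>r\<in>carrier R. (\<forall>u\<in>carrier U. la r u = \<zero>\<^bsub>U\<^esub>) \<longrightarrow> r = \<zero>\<^bsub>R\<^esub>)"

definition torsionless ::
  "('r, 'p) ring_scheme \<Rightarrow> ('u, 'q) ring_scheme \<Rightarrow> ('r \<Rightarrow> 'u \<Rightarrow> 'u) \<Rightarrow> bool" where
  "torsionless R U la \<longleftrightarrow>
    (\<forall>u\<in>carrier U. u \<noteq> \<zero>\<^bsub>U\<^esub> \<longrightarrow>
      (\<exists>f\<in>lhom (carrier R) U la R (\<lambda>r x. r \<otimes>\<^bsub>R\<^esub> x). f u \<noteq> \<zero>\<^bsub>R\<^esub>))"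

definition tuples :: "nat \<Rightarrow> ('u, 'q) ring_scheme \<Rightarrow> (nat \<Rightarrow> 'u) set" where
  "tuples n U = {..<n} \<rightarrow>\<^sub>E carrier U"

definition set_act_tuple :: "('r \<Rightarrow> 'u \<Rightarrow> 'u) \<Rightarrow> 'r set \<Rightarrow> nat \<Rightarrow> (nat \<Rightarrow> 'u) \<Rightarrow> (nat \<Rightarrow> 'u) set" where
  "set_act_tuple la T n u = {(\<lambda>i\<in>{..<n}. la t (u i)) | t. t \<in> T}"

definition ring_center :: "('r, 'p) ring_scheme \<Rightarrow> 'r set" where
  "ring_center R = {z \<in> carrier R. \<forall>r\<in>carrier R. z \<otimes>\<^bsub>R\<^esub> r = r \<otimes>\<^bsub>R\<^esub> z}"

subsection \<open>Injectivity, cogenerators and flatness\<close>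

type_synonym ('r, 'm) univ = "(nat \<Rightarrow> 'r + 'm) set"

text \<open>
  These notions quantify over all modules of a category.  A formula of HOL can only quantify over
  the modules whose carrier lies in a given type \<open>'w\<close>, which is a parameter of the definitions
  below.  They are meant to be used at \<^typ>\<open>('r, 'm) univ\<close> for an \<open>R\<close>-module \<open>M\<close>, with
  \<open>R :: 'r ring\<close> and \<open>M :: 'm ring\<close>.  Up to isomorphism this type contains \<open>R\<close>, \<open>M\<close> and all
  subquotients of their finite and countable direct sums, and it is large enough for all three
  notions to agree with the unrestricted ones: injectivity is decided by the right ideals of \<open>R\<close>
  (Baer), flatness by the inclusions of right ideals into \<open>R\<close>, and a cogenerator is recognised on
  the injective hulls of the simple modules \<open>R/m\<close>, which embed in \<open>Hom(R, \<rat>/\<int>)\<close> and thus have at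
  most as many elements as \<^typ>\<open>('r, 'm) univ\<close>.
\<close>

definition injective ::
  "'w itself \<Rightarrow> ('c, 'p) ring_scheme \<Rightarrow> ('z, 'q) ring_scheme \<Rightarrow> ('z \<Rightarrow> 'c \<Rightarrow> 'z) \<Rightarrow> bool" where
  "injective (_ :: 'w itself) C Z za \<longleftrightarrow>
    (\<forall>(A :: 'w ring) aa (B :: 'w ring) ba. right_module C A aa \<and> right_module C B ba \<longrightarrow>
      (\<forall>i\<in>rhom (carrier C) A aa B ba. inj_on i (carrier A) \<longrightarrow>
        (\<forall>g\<in>rhom (carrier C) A aa Z za. \<exists>h\<in>rhom (carrier C) B ba Z za.
          \<forall>x\<in>carrier A. h (i x) = g x)))"

definition cogenerator ::
  "'w itself \<Rightarrow> ('c, 'p) ring_scheme \<Rightarrow> ('z, 'q) ring_scheme \<Rightarrow> ('z \<Rightarrow> 'c \<Rightarrow> 'z) \<Rightarrow> bool" where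
  "cogenerator (_ :: 'w itself) C Z za \<longleftrightarrow>
    (\<forall>(W :: 'w ring) wa. right_module C W wa \<longrightarrow>
      (\<forall>w\<in>carrier W. w \<noteq> \<zero>\<^bsub>W\<^esub> \<longrightarrow> (\<exists>f\<in>rhom (carrier C) W wa Z za. f w \<noteq> \<zero>\<^bsub>Z\<^esub>)))"

text \<open>
  \<open>A \<otimes>\<^sub>R U\<close> as the free abelian group on the pairs modulo the usual relators.  The group
  \<^const>\<open>free_Abelian_group\<close> is written multiplicatively in the library, its operation being the
  addition of formal sums.
\<close>

definition tensor_rel ::
  "('r, 'p) ring_scheme \<Rightarrow> ('a, 'q) ring_scheme \<Rightarrow> ('a \<Rightarrow> 'r \<Rightarrow> 'a)
    \<Rightarrow> ('u, 's) ring_scheme \<Rightarrow> ('r \<Rightarrow> 'u \<Rightarrow> 'u) \<Rightarrow> ('a \<times> 'u \<Rightarrow>\<^sub>0 int) set" where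
  "tensor_rel R A aa U la = generate (free_Abelian_group (carrier A \<times> carrier U))
    ({frag_of (a \<oplus>\<^bsub>A\<^esub> b, u) - (frag_of (a, u) + frag_of (b, u)) | a b u.
        a \<in> carrier A \<and> b \<in> carrier A \<and> u \<in> carrier U} \<union>
     {frag_of (a, u \<oplus>\<^bsub>U\<^esub> v) - (frag_of (a, u) + frag_of (a, v)) | a u v.
        a \<in> carrier A \<and> u \<in> carrier U \<and> v \<in> carrier U} \<union>
     {frag_of (aa a r, u) - frag_of (a, la r u) | a r u.
        a \<in> carrier A \<and> r \<in> carrier R \<and> u \<in> carrier U})"

definition tensor ::
  "('r, 'p) ring_scheme \<Rightarrow> ('a, 'q) ring_scheme \<Rightarrow> ('a \<Rightarrow> 'r \<Rightarrow> 'a)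
    \<Rightarrow> ('u, 's) ring_scheme \<Rightarrow> ('r \<Rightarrow> 'u \<Rightarrow> 'u) \<Rightarrow> ('a \<times> 'u \<Rightarrow>\<^sub>0 int) set monoid" where
  "tensor R A aa U la =
    free_Abelian_group (carrier A \<times> carrier U) Mod tensor_rel R A aa U la"

text \<open>
  The map \<open>f \<otimes> id : A \<otimes>\<^sub>R U \<rightarrow> B \<otimes>\<^sub>R U\<close>.  The image of a coset under the map of free groups is
  contained in a single coset of the target relations; adding these relations gives that coset.
\<close>

definition tensor_map ::
  "('r, 'p) ring_scheme \<Rightarrow> ('b, 'q) ring_scheme \<Rightarrow> ('b \<Rightarrow> 'r \<Rightarrow> 'b)
    \<Rightarrow> ('u, 's) ring_scheme \<Rightarrow> ('r \<Rightarrow> 'u \<Rightarrow> 'u) \<Rightarrow> ('a \<Rightarrow> 'b)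
    \<Rightarrow> ('a \<times> 'u \<Rightarrow>\<^sub>0 int) set \<Rightarrow> ('b \<times> 'u \<Rightarrow>\<^sub>0 int) set" where
  "tensor_map R B ba U la f X = tensor_rel R B ba U la
    <#>\<^bsub>free_Abelian_group (carrier B \<times> carrier U)\<^esub> frag_extend (\<lambda>(a, u). frag_of (f a, u)) ` X"

definition flat ::
  "'w itself \<Rightarrow> ('r, 'p) ring_scheme \<Rightarrow> ('u, 'q) ring_scheme \<Rightarrow> ('r \<Rightarrow> 'u \<Rightarrow> 'u) \<Rightarrow> bool" where
  "flat (_ :: 'w itself) R U la \<longleftrightarrow>
    (\<forall>(A :: 'w ring) aa (B :: 'w ring) ba. right_module R A aa \<and> right_module R B ba \<longrightarrow>
      (\<forall>f\<in>rhom (carrier R) A aa B ba. inj_on f (carrier A) \<longrightarrow>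
        inj_on (tensor_map R B ba U la f) (carrier (tensor R A aa U la))))"

end

theory Submission
  imports Defs
begin

text \<open>
  For \<open>f \<in> Hom_R(U, R)\<close> and \<open>w \<in> U\<close> the map \<open>x \<mapsto> f(x) w\<close> is an endomorphism of \<open>U\<close>, so every
  \<open>b \<in> B\<close> satisfies \<open>b(f(x) w) = f(b x) w\<close>.  Summing, for each \<open>t \<in> T\<close> there is one \<open>r\<close> with
  \<open>b(t w) = r w\<close> for all \<open>w\<close>; choosing \<open>t\<close> with \<open>t u = u\<close> on the given finite set yields (i).

  For (ii), the tuples \<open>(\<rho>\<^sub>j(r u\<^sub>j))\<^sub>j\<close>, \<open>r \<in> R\<close>, form a \<open>C\<close>-submodule \<open>D\<close> of \<open>Z\<^sup>n\<close>.  If it did not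
  contain \<open>((\<rho>\<^sub>j s)(u\<^sub>j))\<^sub>j\<close>, the cogenerator would provide a homomorphism \<open>Z\<^sup>n \<rightarrow> Z\<close>, given by
  scalars \<open>c\<^sub>j\<close>, that vanishes on \<open>D\<close> but not on this tuple.  Put \<open>w\<^sub>j = u\<^sub>j c\<^sub>j\<close>.  Then
  \<open>\<Sum> \<rho>\<^sub>j(r w\<^sub>j) = 0\<close> for all \<open>r\<close>.  As \<open>s\<close> commutes with \<open>\<rho> \<mapsto> \<rho> \<circ> (f(\<cdot>) w)\<close>, it follows that
  \<open>\<Sum> (\<rho>\<^sub>j s)(f(v) w\<^sub>j) = 0\<close>, hence \<open>\<Sum> (\<rho>\<^sub>j s)(t w\<^sub>j) = 0\<close> for all \<open>t \<in> T\<close>, contradicting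
  \<open>t w\<^sub>j = w\<^sub>j\<close> for a suitable \<open>t\<close>.
\<close>

section \<open>Homomorphisms and the trace ideal\<close>

lemma lhomD:
  assumes "f \<in> lhom S M am N an"
  shows "x \<in> carrier M \<Longrightarrow> f x \<in> carrier N"
    and "\<lbrakk>x \<in> carrier M; y \<in> carrier M\<rbrakk> \<Longrightarrow> f (x \<oplus>\<^bsub>M\<^esub> y) = f x \<oplus>\<^bsub>N\<^esub> f y"
    and "\<lbrakk>s \<in> S; x \<in> carrier M\<rbrakk> \<Longrightarrow> f (am s x) = an s (f x)"
  using assms unfolding lhom_def by auto

lemma rhomD:
  assumes "f \<in> rhom S M am N an"
  shows "x \<in> carrier M \<Longrightarrow> f x \<in> carrier N"
    and "\<lbrakk>x \<in> carrier M; y \<in> carrier M\<rbrakk> \<Longrightarrow> f (x \<oplus>\<^bsub>M\<^esub> y) = f x \<oplus>\<^bsub>N\<^esub> f y"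
    and "\<lbrakk>s \<in> S; x \<in> carrier M\<rbrakk> \<Longrightarrow> f (am x s) = an (f x) s"
  using assms unfolding rhom_def by auto

text \<open>Homomorphisms and actions are only required to be additive; that they respect zero comes
  from 0 + 0 = 0 by cancellation.\<close>

lemma (in abelian_group) zero_if_double: "\<lbrakk>x \<in> carrier G; x \<oplus> x = x\<rbrakk> \<Longrightarrow> x = \<zero>"
  using add.r_cancel_one[of x x] by simp

lemma (in abelian_group) minus_zero_right: "x \<in> carrier G \<Longrightarrow> x \<ominus> \<zero> = x"
  using minus_equality[of \<zero> \<zero>] by (simp add: a_minus_def)

lemma rhom_zero:
  assumes "f \<in> rhom S M am N an" "abelian_group M" "abelian_group N"
  shows "f \<zero>\<^bsub>M\<^esub> = \<zero>\<^bsub>N\<^esub>"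
proof -
  interpret M: abelian_group M by fact
  interpret N: abelian_group N by fact
  show ?thesis
    using rhomD(1,2)[OF assms(1), of "\<zero>\<^bsub>M\<^esub>"] by (metis M.zero_closed M.l_zero N.zero_if_double)
qed

lemma lhom_zero:
  assumes "f \<in> lhom S M am N an" "abelian_group M" "abelian_group N"
  shows "f \<zero>\<^bsub>M\<^esub> = \<zero>\<^bsub>N\<^esub>"
proof -
  interpret M: abelian_group M by fact
  interpret N: abelian_group N by fact
  show ?thesis
    using lhomD(1,2)[OF assms(1), of "\<zero>\<^bsub>M\<^esub>"] by (metis M.zero_closed M.l_zero N.zero_if_double)
qed

lemma (in left_module) act_zero_scalar: "x \<in> carrier M \<Longrightarrow> act \<zero>\<^bsub>R\<^esub> x = \<zero>\<^bsub>M\<^esub>"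
  using act_l_distr[of "\<zero>\<^bsub>R\<^esub>" "\<zero>\<^bsub>R\<^esub>" x] act_closed[of "\<zero>\<^bsub>R\<^esub>" x]
  by (intro M.zero_if_double) auto

lemma (in right_module) act_zero_scalar: "x \<in> carrier M \<Longrightarrow> act x \<zero>\<^bsub>R\<^esub> = \<zero>\<^bsub>M\<^esub>"
  using act_r_distr[of "\<zero>\<^bsub>R\<^esub>" "\<zero>\<^bsub>R\<^esub>" x] act_closed[of "\<zero>\<^bsub>R\<^esub>" x]
  by (intro M.zero_if_double) auto

lemma (in right_module) act_zero: "r \<in> carrier R \<Longrightarrow> act \<zero>\<^bsub>M\<^esub> r = \<zero>\<^bsub>M\<^esub>"
  using act_l_distr[of r "\<zero>\<^bsub>M\<^esub>" "\<zero>\<^bsub>M\<^esub>"] act_closed[of r "\<zero>\<^bsub>M\<^esub>"]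
  by (intro M.zero_if_double) auto

lemma (in abelian_monoid) finsum_lessThan_Suc:
  assumes "\<And>i. i < Suc n \<Longrightarrow> f i \<in> carrier G"
  shows "(\<Oplus>i\<in>{..<Suc n}. f i) = (\<Oplus>i\<in>{..<n}. f i) \<oplus> f n"
proof -
  have "(\<Oplus>i\<in>insert n {..<n}. f i) = f n \<oplus> (\<Oplus>i\<in>{..<n}. f i)"
    by (rule finsum_insert) (use assms in auto)
  then show ?thesis
    using assms by (simp add: lessThan_Suc a_comm)
qed

section \<open>Induction over the trace ideal and the endomorphisms it provides\<close>

text \<open>A trace element is built by adding one value \<open>f v\<close> at a time, so a property
  passes along the partial sums of any representation.\<close>

lemma trace_ideal_induct [consumes 2, case_names zero add]:
  assumes "t \<in> trace_ideal R U la" and "ring R"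
    and zero: "P \<zero>\<^bsub>R\<^esub>"
    and add: "\<And>t f v. \<lbrakk>t \<in> carrier R; P t; f \<in> lhom (carrier R) U la R (\<lambda>r x. r \<otimes>\<^bsub>R\<^esub> x); v \<in> carrier U\<rbrakk>
      \<Longrightarrow> P (t \<oplus>\<^bsub>R\<^esub> f v)"
  shows "P t"
proof -
  interpret R: ring R by fact
  obtain n :: nat and f v where t: "t = (\<Oplus>\<^bsub>R\<^esub>i\<in>{..<n}. f i (v i))"
    and fv: "\<And>i. i < n \<Longrightarrow> f i \<in> lhom (carrier R) U la R (\<lambda>r x. r \<otimes>\<^bsub>R\<^esub> x)"
      "\<And>i. i < n \<Longrightarrow> v i \<in> carrier U"
    using assms(1) unfolding trace_ideal_def by auto
  \<comment> \<open>The claim is extended to all initial segments of the chosen representation,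
    which makes induction on the length possible.\<close>
  have "P (\<Oplus>\<^bsub>R\<^esub>i\<in>{..<k}. f i (v i))" if "k \<le> n" for k
    using that
  proof (induction k)
    case 0
    then show ?case using zero by simp
  next
    case (Suc k)
    have cl: "f i (v i) \<in> carrier R" if "i < Suc k" for i
      using that Suc.prems fv lhomD(1) by (metis less_le_trans)
    have "P ((\<Oplus>\<^bsub>R\<^esub>i\<in>{..<k}. f i (v i)) \<oplus>\<^bsub>R\<^esub> f k (v k))"
      using Suc fv cl by (intro add R.finsum_closed) auto
    then show ?case
      using R.finsum_lessThan_Suc[of k "\<lambda>i. f i (v i)"] cl by simp
  qed
  then show ?thesis using t by simp
qed

text \<open>The map is \<open>f\<close> followed by right multiplication from R to U, sending r to r
  w; both are R-linear. These are the endomorphisms against which biendomorphisms are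
  tested.\<close>

lemma lhom_mult_endo:
  assumes "left_module R U la" and f: "f \<in> lhom (carrier R) U la R (\<lambda>r x. r \<otimes>\<^bsub>R\<^esub> x)"
    and w: "w \<in> carrier U"
  shows "(\<lambda>x\<in>carrier U. la (f x) w) \<in> lhom (carrier R) U la U la"
proof -
  interpret left_module R U la by fact
  show ?thesis
    using lhomD[OF f] w unfolding lhom_def
    by (auto simp: act_closed act_l_distr act_assoc)
qed

section \<open>Density in the biendomorphism ring\<close>

text \<open>For t = \<Sum> f_i(v_i) the scalar r = \<Sum> f_i(b v_i) works. It does not depend on
  \<open>w\<close>, which is what later serves all elements of a finite set at once.\<close>

lemma lbiend_trace:
  assumes "left_module R U la" and b: "b \<in> lbiend R U la" and "t \<in> trace_ideal R U la"
  shows "\<exists>r\<in>carrier R. \<forall>w\<in>carrier U. b (la t w) = la r w"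
proof -
  interpret left_module R U la by fact
  note b' = lhomD[OF b[unfolded lbiend_def]]
  have b0: "b \<zero>\<^bsub>U\<^esub> = \<zero>\<^bsub>U\<^esub>"
    using lhom_zero[OF b[unfolded lbiend_def]] M.abelian_group_axioms by blast
  show ?thesis
    using assms(3) R.ring_axioms
  proof (induction rule: trace_ideal_induct)
    case zero
    then show ?case using act_zero_scalar b0 by (intro bexI[of _ "\<zero>\<^bsub>R\<^esub>"]) auto
  next
    case (add t f v)
    then obtain r where r: "r \<in> carrier R" "\<And>w. w \<in> carrier U \<Longrightarrow> b (la t w) = la r w"
      by auto
    note f = lhomD[OF add.hyps(2)]
    have "b (la (t \<oplus>\<^bsub>R\<^esub> f v) w) = la (r \<oplus>\<^bsub>R\<^esub> f (b v)) w" if w: "w \<in> carrier U" for w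
    proof -
      \<comment> \<open>Here \<open>b\<close> commutes with the endomorphism sending x to f(x) w,
        evaluated at \<open>v\<close>.\<close>
      have "b (la (f v) w) = la (f (b v)) w"
        using b'(3)[OF lhom_mult_endo[OF assms(1) add.hyps(2) w] add.hyps(3)] add.hyps(3) b'(1) by simp
      then show ?thesis
        using add.hyps r w f(1) b'(1,2) by (simp add: act_l_distr act_closed)
    qed
    then show ?case
      using r(1) f(1) b'(1) add.hyps(3) by (intro bexI[of _ "r \<oplus>\<^bsub>R\<^esub> f (b v)"]) auto
  qed
qed

text \<open>Tuples are extensional functions, so \<open>u\<close> is restricted to
  \<open>{..<n}\<close> before the hypothesis is applied; the tuple equation is then read off entry
  by entry.\<close>

lemma trace_ideal_fixes:
  assumes "\<And>n u. u \<in> tuples n U \<Longrightarrow> u \<in> set_act_tuple la (trace_ideal R U la) n u"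
    and u: "\<And>i::nat. i < n \<Longrightarrow> u i \<in> carrier U"
  shows "\<exists>t\<in>trace_ideal R U la. \<forall>i<n. la t (u i) = u i"
proof -
  have "restrict u {..<n} \<in> set_act_tuple la (trace_ideal R U la) n (restrict u {..<n})"
    using u by (intro assms(1)) (auto simp: tuples_def)
  then obtain t where t: "t \<in> trace_ideal R U la"
    and eq: "restrict u {..<n} = (\<lambda>i\<in>{..<n}. la t (restrict u {..<n} i))"
    unfolding set_act_tuple_def by auto
  have "la t (u i) = u i" if "i < n" for i
    using fun_cong[OF eq, of i] that by simp
  with t show ?thesis by blast
qed

lemma finite_enumerate:
  assumes "finite G"
  obtains n :: nat and h where "G = h ` {..<n}"
  using ex_bij_betw_nat_finite[OF assms]
  by (metis atLeast0LessThan bij_betw_imp_surj_on)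

text \<open>With t in the trace ideal fixing every element of \<open>G\<close>, and r the scalar
  that describes \<open>b\<close> after multiplication by t, one gets b u = b(t u) = r u.\<close>

lemma lbiend_dense:
  assumes "left_module R U la"
    and fixes_tuples: "\<And>n u. u \<in> tuples n U \<Longrightarrow> u \<in> set_act_tuple la (trace_ideal R U la) n u"
    and b: "b \<in> lbiend R U la" and G: "finite G" "G \<subseteq> carrier U"
  shows "\<exists>r\<in>carrier R. \<forall>u\<in>G. la r u = b u"
proof -
  obtain n :: nat and h where h: "G = h ` {..<n}"
    by (rule finite_enumerate[OF G(1)])
  have hU: "h i \<in> carrier U" if "i < n" for i
    using that h G(2) by auto
  obtain t where t: "t \<in> trace_ideal R U la" "\<And>i. i < n \<Longrightarrow> la t (h i) = h i"
    using trace_ideal_fixes[where u = h, OF fixes_tuples hU] by auto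
  obtain r where "r \<in> carrier R" "\<forall>w\<in>carrier U. b (la t w) = la r w"
    using lbiend_trace[OF assms(1) b t(1)] by auto
  then show ?thesis
    using t(2) hU unfolding h by (metis (no_types, lifting) imageE lessThan_iff)
qed

section \<open>Separating submodules by a cogenerator\<close>

text \<open>
  The fibres of \<open>\<pi>\<close> are the cosets of the submodule \<open>D\<close>: transporting the operations along \<open>\<pi>\<close>
  realises \<open>M/D\<close> inside the type \<^typ>\<open>'w\<close> over which the cogenerator property quantifies.
\<close>

lemma cogenerator_separates:
  fixes \<pi> :: "'m \<Rightarrow> 'w"
  assumes "cogenerator TYPE('w) C Z za" and "right_module C M ma" and "right_module C Z za"
    and D: "D \<subseteq> carrier M" "\<zero>\<^bsub>M\<^esub> \<in> D"
      "\<And>x y. \<lbrakk>x \<in> D; y \<in> D\<rbrakk> \<Longrightarrow> x \<oplus>\<^bsub>M\<^esub> y \<in> D"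
      "\<And>x c. \<lbrakk>x \<in> D; c \<in> carrier C\<rbrakk> \<Longrightarrow> ma x c \<in> D"
    and \<pi>: "\<And>x y. \<lbrakk>x \<in> carrier M; y \<in> carrier M\<rbrakk> \<Longrightarrow> \<pi> x = \<pi> y \<longleftrightarrow> x \<ominus>\<^bsub>M\<^esub> y \<in> D"
    and x: "x \<in> carrier M" "x \<notin> D"
  obtains f where "f \<in> rhom (carrier C) M ma Z za" "\<And>d. d \<in> D \<Longrightarrow> f d = \<zero>\<^bsub>Z\<^esub>" "f x \<noteq> \<zero>\<^bsub>Z\<^esub>"
proof -
  interpret M: right_module C M ma by fact
  interpret Z: right_module C Z za by fact
  \<comment> \<open>A choice of representative in each coset. The congruence facts that follow make
    the transported operations independent of it.\<close>
  define g where "g = inv_into (carrier M) \<pi>"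
  have g: "g (\<pi> y) \<in> carrier M" "\<pi> (g (\<pi> y)) = \<pi> y" if "y \<in> carrier M" for y
    using that unfolding g_def by (auto simp: inv_into_into f_inv_into_f)
  have cong_add: "\<pi> (a \<oplus>\<^bsub>M\<^esub> b) = \<pi> (a' \<oplus>\<^bsub>M\<^esub> b')"
    if "a \<in> carrier M" "b \<in> carrier M" "a' \<in> carrier M" "b' \<in> carrier M" "\<pi> a = \<pi> a'" "\<pi> b = \<pi> b'"
    for a b a' b'
  proof -
    have "(a \<oplus>\<^bsub>M\<^esub> b) \<ominus>\<^bsub>M\<^esub> (a' \<oplus>\<^bsub>M\<^esub> b') = (a \<ominus>\<^bsub>M\<^esub> a') \<oplus>\<^bsub>M\<^esub> (b \<ominus>\<^bsub>M\<^esub> b')"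
      using that by (simp add: M.M.minus_add M.M.a_ac a_minus_def)
    then show ?thesis using that \<pi> D(3) by simp
  qed
  have cong_act: "\<pi> (ma a c) = \<pi> (ma a' c)"
    if "a \<in> carrier M" "a' \<in> carrier M" "\<pi> a = \<pi> a'" "c \<in> carrier C" for a a' c
  proof -
    have "ma (a \<ominus>\<^bsub>M\<^esub> a') c \<oplus>\<^bsub>M\<^esub> ma a' c = ma a c"
      using that M.act_l_distr[of c "a \<ominus>\<^bsub>M\<^esub> a'" a'] by (simp add: a_minus_def M.M.a_assoc M.M.l_neg)
    then have "ma a c \<ominus>\<^bsub>M\<^esub> ma a' c = ma (a \<ominus>\<^bsub>M\<^esub> a') c"
      using that M.act_closed
      by (metis M.M.a_assoc M.M.minus_closed M.M.r_neg M.M.r_zero M.M.a_inv_closed a_minus_def)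
    then show ?thesis using that \<pi> D(4) M.act_closed by simp
  qed
  define W :: "'w ring" where
    "W = \<lparr>carrier = \<pi> ` carrier M, monoid.mult = undefined, monoid.one = undefined,
      ring.zero = \<pi> \<zero>\<^bsub>M\<^esub>, ring.add = (\<lambda>a b. \<pi> (g a \<oplus>\<^bsub>M\<^esub> g b))\<rparr>"
  define wa where "wa a c = \<pi> (ma (g a) c)" for a c
  have carW: "carrier W = \<pi> ` carrier M" and zeroW: "\<zero>\<^bsub>W\<^esub> = \<pi> \<zero>\<^bsub>M\<^esub>"
    unfolding W_def by auto
  have addW: "\<pi> a \<oplus>\<^bsub>W\<^esub> \<pi> b = \<pi> (a \<oplus>\<^bsub>M\<^esub> b)" if "a \<in> carrier M" "b \<in> carrier M" for a b
    using cong_add[OF g(1) g(1) that g(2) g(2)] that unfolding W_def by simp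
  have actW: "wa (\<pi> a) c = \<pi> (ma a c)" if "a \<in> carrier M" "c \<in> carrier C" for a c
    using cong_act[OF g(1) that(1) g(2) that(2)] that unfolding wa_def by simp
  have "abelian_group W"
  proof (rule abelian_groupI)
    fix a assume "a \<in> carrier W"
    then obtain a' where "a = \<pi> a'" "a' \<in> carrier M" unfolding carW by auto
    then show "\<exists>b\<in>carrier W. b \<oplus>\<^bsub>W\<^esub> a = \<zero>\<^bsub>W\<^esub>"
      by (intro bexI[of _ "\<pi> (\<ominus>\<^bsub>M\<^esub> a')"]) (auto simp: addW zeroW carW M.M.l_neg)
  qed (auto simp: addW carW zeroW M.M.a_ac)
  then interpret W: abelian_group W .
  have "right_module C W wa"
    by unfold_locales
      (auto simp: carW addW actW M.act_closed M.act_r_distr M.act_l_distr M.act_assoc M.act_one)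
  \<comment> \<open>The fibre of \<pi> over the zero of \<open>W\<close> is \<open>D\<close>, so an
    element outside \<open>D\<close> has nonzero image.\<close>
  moreover have "\<pi> x \<noteq> \<zero>\<^bsub>W\<^esub>" "\<pi> x \<in> carrier W"
    using x \<pi>[OF x(1) M.M.zero_closed] by (auto simp: zeroW carW M.M.minus_zero_right)
  ultimately obtain f where f: "f \<in> rhom (carrier C) W wa Z za" "f (\<pi> x) \<noteq> \<zero>\<^bsub>Z\<^esub>"
    using assms(1) unfolding cogenerator_def by blast
  have f0: "f (\<pi> \<zero>\<^bsub>M\<^esub>) = \<zero>\<^bsub>Z\<^esub>"
    using rhom_zero[OF f(1) W.abelian_group_axioms Z.M.abelian_group_axioms] zeroW by simp
  show thesis
  proof
    show "(\<lambda>y\<in>carrier M. f (\<pi> y)) \<in> rhom (carrier C) M ma Z za"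
      using rhomD(1-3)[OF f(1)] unfolding rhom_def carW
      by (auto simp: M.act_closed simp flip: addW actW)
    show "(\<lambda>y\<in>carrier M. f (\<pi> y)) d = \<zero>\<^bsub>Z\<^esub>" if "d \<in> D" for d
    proof -
      have "d \<in> carrier M" using that D(1) by auto
      moreover from this have "\<pi> d = \<pi> \<zero>\<^bsub>M\<^esub>"
        using \<pi>[OF _ M.M.zero_closed] that by (simp add: M.M.minus_zero_right)
      ultimately show ?thesis using f0 by simp
    qed
    show "(\<lambda>y\<in>carrier M. f (\<pi> y)) x \<noteq> \<zero>\<^bsub>Z\<^esub>"
      using f(2) x by simp
  qed
qed

section \<open>Finite powers of Z and their homomorphisms to Z\<close>

definition power_module :: "nat \<Rightarrow> ('z, 't) ring_scheme \<Rightarrow> (nat \<Rightarrow> 'z) ring" where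
  "power_module n Z = \<lparr>carrier = tuples n Z, monoid.mult = undefined, monoid.one = undefined,
     ring.zero = (\<lambda>i\<in>{..<n}. \<zero>\<^bsub>Z\<^esub>), ring.add = (\<lambda>x y. \<lambda>i\<in>{..<n}. x i \<oplus>\<^bsub>Z\<^esub> y i)\<rparr>"

definition power_act :: "nat \<Rightarrow> ('z \<Rightarrow> 'c \<Rightarrow> 'z) \<Rightarrow> (nat \<Rightarrow> 'z) \<Rightarrow> 'c \<Rightarrow> nat \<Rightarrow> 'z" where
  "power_act n za x c = (\<lambda>i\<in>{..<n}. za (x i) c)"

lemma power_module_simps:
  "carrier (power_module n Z) = {..<n} \<rightarrow>\<^sub>E carrier Z"
  "\<zero>\<^bsub>power_module n Z\<^esub> = (\<lambda>i\<in>{..<n}. \<zero>\<^bsub>Z\<^esub>)"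
  "x \<oplus>\<^bsub>power_module n Z\<^esub> y = (\<lambda>i\<in>{..<n}. x i \<oplus>\<^bsub>Z\<^esub> y i)"
  unfolding power_module_def tuples_def by auto

lemma right_module_power:
  assumes "right_module C Z za"
  shows "right_module C (power_module n Z) (power_act n za)"
proof -
  interpret Z: right_module C Z za by fact
  have "abelian_group (power_module n Z)"
  proof (rule abelian_groupI)
    fix x assume "x \<in> carrier (power_module n Z)"
    then show "\<exists>y\<in>carrier (power_module n Z). y \<oplus>\<^bsub>power_module n Z\<^esub> x = \<zero>\<^bsub>power_module n Z\<^esub>"
      by (intro bexI[of _ "\<lambda>i\<in>{..<n}. \<ominus>\<^bsub>Z\<^esub> x i"])
        (auto simp: power_module_simps PiE_iff Z.M.l_neg fun_eq_iff)
  qed (auto simp: power_module_simps PiE_iff fun_eq_iff Z.M.a_ac extensional_def)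
  then interpret P: abelian_group "power_module n Z" .
  show ?thesis
    by unfold_locales
      (auto simp: power_module_simps power_act_def PiE_iff fun_eq_iff extensional_def
        Z.act_closed Z.act_r_distr Z.act_l_distr Z.act_assoc Z.act_one)
qed

text \<open>Composing \<open>f\<close> with the inclusion of the i-th coordinate gives an
  endomorphism of Z, hence a scalar \<open>c i\<close>; additivity then determines \<open>f\<close>
  on all tuples.\<close>

lemma rhom_power_module:
  fixes Z :: "('z, 't) ring_scheme"
  assumes "right_module C Z za"
    and f: "f \<in> rhom (carrier C) (power_module n Z) (power_act n za) Z za"
    and end_scalar: "\<forall>f\<in>rhom (carrier C) Z za Z za. \<exists>c\<in>carrier C. \<forall>z\<in>carrier Z. f z = za z c"
  obtains c where "\<And>i. i < n \<Longrightarrow> c i \<in> carrier C"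
    "\<And>x. x \<in> carrier (power_module n Z) \<Longrightarrow> f x = (\<Oplus>\<^bsub>Z\<^esub>i\<in>{..<n}. za (x i) (c i))"
proof -
  interpret Z: right_module C Z za by fact
  interpret P: right_module C "power_module n Z" "power_act n za"
    by (rule right_module_power[OF assms(1)])
  note f' = rhomD[OF f]
  \<comment> \<open>\<open>e i\<close> is the inclusion of Z as the i-th coordinate of the
    power.\<close>
  define e where "e i z = (\<lambda>j\<in>{..<n}. if j = i then z else \<zero>\<^bsub>Z\<^esub>)" for i and z :: 'z
  have e: "e i z \<in> carrier (power_module n Z)" if "z \<in> carrier Z" for i z
    using that by (auto simp: e_def power_module_simps)
  have "\<exists>c\<in>carrier C. \<forall>z\<in>carrier Z. f (e i z) = za z c" if "i < n" for i
  proof -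
    have "e i (y \<oplus>\<^bsub>Z\<^esub> z) = e i y \<oplus>\<^bsub>power_module n Z\<^esub> e i z"
      if "y \<in> carrier Z" "z \<in> carrier Z" for y z
      using that by (auto simp: e_def power_module_simps)
    moreover have "e i (za z c) = power_act n za (e i z) c" if "z \<in> carrier Z" "c \<in> carrier C" for z c
      using that Z.act_zero by (auto simp: e_def power_act_def)
    ultimately have "(\<lambda>z\<in>carrier Z. f (e i z)) \<in> rhom (carrier C) Z za Z za"
      using e f' by (auto simp: rhom_def Z.act_closed)
    then obtain c where "c \<in> carrier C" "\<forall>z\<in>carrier Z. (\<lambda>z\<in>carrier Z. f (e i z)) z = za z c"
      using end_scalar by blast
    then show ?thesis by auto
  qed
  then obtain c where c: "\<And>i. i < n \<Longrightarrow> c i \<in> carrier C"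
    "\<And>i z. \<lbrakk>i < n; z \<in> carrier Z\<rbrakk> \<Longrightarrow> f (e i z) = za z (c i)"
    by metis
  have "f x = (\<Oplus>\<^bsub>Z\<^esub>i\<in>{..<n}. za (x i) (c i))" if x: "x \<in> carrier (power_module n Z)" for x
  proof -
    \<comment> \<open>\<open>cut k\<close> keeps the first k entries of \<open>x\<close> and
      replaces the others by zero. It runs from the zero tuple at k = 0 to \<open>x\<close> at k =
      n, gaining one coordinate inclusion per step.\<close>
    define cut where "cut k = (\<lambda>j\<in>{..<n}. if j < k then x j else \<zero>\<^bsub>Z\<^esub>)" for k
    have xi: "x i \<in> carrier Z" if "i < n" for i
      using that x by (auto simp: power_module_simps)
    have cut: "cut k \<in> carrier (power_module n Z)" for k
      using xi by (auto simp: cut_def power_module_simps)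
    have "f (cut k) = (\<Oplus>\<^bsub>Z\<^esub>i\<in>{..<k}. za (x i) (c i))" if "k \<le> n" for k
      using that
    proof (induction k)
      case 0
      have "cut 0 = \<zero>\<^bsub>power_module n Z\<^esub>"
        by (simp add: cut_def power_module_simps)
      then show ?case
        using rhom_zero[OF f P.M.abelian_group_axioms Z.M.abelian_group_axioms] by simp
    next
      case (Suc k)
      have "cut (Suc k) = cut k \<oplus>\<^bsub>power_module n Z\<^esub> e k (x k)"
        using Suc.prems xi by (auto simp: cut_def e_def power_module_simps fun_eq_iff)
      then have "f (cut (Suc k)) = f (cut k) \<oplus>\<^bsub>Z\<^esub> za (x k) (c k)"
        using Suc.prems f'(2) cut e xi c(2) by simp
      then show ?case
        using Suc xi c(1) Z.act_closed by (simp add: Z.M.finsum_lessThan_Suc)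
    qed
    moreover have "cut n = x"
      using x by (auto simp: cut_def power_module_simps PiE_iff extensional_def)
    ultimately show ?thesis by auto
  qed
  with c(1) that show thesis by blast
qed

text \<open>The separating homomorphism on the power of Z is rewritten in terms of scalars. What has
  to be supplied is a model of the quotient by \<open>D\<close> inside the type
  \<open>('c, 'z) univ\<close>.\<close>

lemma cogenerator_separates_power:
  fixes C :: "('c, 'q) ring_scheme" and Z :: "('z, 't) ring_scheme"
  assumes cogen: "cogenerator TYPE(('c, 'z) univ) C Z za" and Z: "right_module C Z za"
    and end_scalar: "\<forall>f\<in>rhom (carrier C) Z za Z za. \<exists>c\<in>carrier C. \<forall>z\<in>carrier Z. f z = za z c"
    and D: "D \<subseteq> carrier (power_module n Z)" "\<zero>\<^bsub>power_module n Z\<^esub> \<in> D"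
      "\<And>x y. \<lbrakk>x \<in> D; y \<in> D\<rbrakk> \<Longrightarrow> x \<oplus>\<^bsub>power_module n Z\<^esub> y \<in> D"
      "\<And>x c. \<lbrakk>x \<in> D; c \<in> carrier C\<rbrakk> \<Longrightarrow> power_act n za x c \<in> D"
    and x: "x \<in> carrier (power_module n Z)" "x \<notin> D"
  shows "\<exists>c. (\<forall>i<n. c i \<in> carrier C) \<and>
    (\<forall>d\<in>D. (\<Oplus>\<^bsub>Z\<^esub>i\<in>{..<n}. za (d i) (c i)) = \<zero>\<^bsub>Z\<^esub>) \<and>
    (\<Oplus>\<^bsub>Z\<^esub>i\<in>{..<n}. za (x i) (c i)) \<noteq> \<zero>\<^bsub>Z\<^esub>"
proof -
  interpret Z: right_module C Z za by fact
  interpret P: right_module C "power_module n Z" "power_act n za"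
    by (rule right_module_power[OF Z])
  let ?P = "power_module n Z"
  \<comment> \<open>The coset of \<open>y\<close>, as a set of tuples; composing with
    \<open>Inr\<close> moves these injectively into the type required by the cogenerator
    hypothesis.\<close>
  define \<pi> :: "(nat \<Rightarrow> 'z) \<Rightarrow> ('c, 'z) univ" where
    "\<pi> y = (\<lambda>d. Inr \<circ> (d \<oplus>\<^bsub>?P\<^esub> y)) ` D" for y
  have inj: "y = z" if "Inr \<circ> y = (Inr \<circ> z :: nat \<Rightarrow> 'c + 'z)" for y z :: "nat \<Rightarrow> 'z"
    using that by (auto simp: fun_eq_iff)
  \<comment> \<open>Negatives are obtained from the action of the scalar -1, so closure under sums
    and scalars makes \<open>D\<close> a subgroup.\<close>
  have neg_D: "\<ominus>\<^bsub>?P\<^esub> d \<in> D" if d: "d \<in> D" for d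
  proof -
    have dP: "d \<in> carrier ?P" using d D(1) by auto
    let ?m = "\<ominus>\<^bsub>C\<^esub> \<one>\<^bsub>C\<^esub>"
    have "power_act n za d ?m \<oplus>\<^bsub>?P\<^esub> d = power_act n za d ?m \<oplus>\<^bsub>?P\<^esub> power_act n za d \<one>\<^bsub>C\<^esub>"
      using P.act_one dP by simp
    also have "\<dots> = \<zero>\<^bsub>?P\<^esub>"
      using P.act_r_distr[of ?m "\<one>\<^bsub>C\<^esub>" d] dP P.act_zero_scalar by (simp add: Z.R.l_neg)
    finally have "power_act n za d ?m = \<ominus>\<^bsub>?P\<^esub> d"
      using dP P.act_closed[of ?m d] P.M.minus_equality by simp
    then show ?thesis using D(4)[OF d, of ?m] by simp
  qed
  have "\<pi> y = \<pi> z \<longleftrightarrow> y \<ominus>\<^bsub>?P\<^esub> z \<in> D" if yz: "y \<in> carrier ?P" "z \<in> carrier ?P" for y z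
  proof
    assume "\<pi> y = \<pi> z"
    moreover have "Inr \<circ> (\<zero>\<^bsub>?P\<^esub> \<oplus>\<^bsub>?P\<^esub> y) \<in> \<pi> y"
      unfolding \<pi>_def using D(2) by (rule imageI)
    ultimately obtain d where d: "d \<in> D" "\<zero>\<^bsub>?P\<^esub> \<oplus>\<^bsub>?P\<^esub> y = d \<oplus>\<^bsub>?P\<^esub> z"
      unfolding \<pi>_def using inj by blast
    moreover have "d \<in> carrier ?P" using d(1) D(1) by auto
    ultimately have "y \<ominus>\<^bsub>?P\<^esub> z = d"
      using yz by (simp add: a_minus_def P.M.a_assoc P.M.r_neg)
    then show "y \<ominus>\<^bsub>?P\<^esub> z \<in> D" using d by simp
  next
    \<comment> \<open>One inclusion of cosets is proved for arbitrary arguments; the reverse one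
      follows by exchanging them, as \<open>neg_D\<close> puts the opposite difference in
      \<open>D\<close>.\<close>
    have sub: "\<pi> y \<subseteq> \<pi> z"
      if "y \<ominus>\<^bsub>?P\<^esub> z \<in> D" and yz: "y \<in> carrier ?P" "z \<in> carrier ?P" for y z
    proof
      fix a assume "a \<in> \<pi> y"
      then obtain d where d: "d \<in> D" "a = Inr \<circ> (d \<oplus>\<^bsub>?P\<^esub> y)" unfolding \<pi>_def by auto
      have dP: "d \<in> carrier ?P" using d(1) D(1) by auto
      have "d \<oplus>\<^bsub>?P\<^esub> y = (d \<oplus>\<^bsub>?P\<^esub> (y \<ominus>\<^bsub>?P\<^esub> z)) \<oplus>\<^bsub>?P\<^esub> z"
        using yz dP by (simp add: a_minus_def P.M.a_assoc P.M.l_neg)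
      then show "a \<in> \<pi> z"
        using D(3)[OF d(1) that(1)] d(2) unfolding \<pi>_def by auto
    qed
    assume 1: "y \<ominus>\<^bsub>?P\<^esub> z \<in> D"
    have "\<ominus>\<^bsub>?P\<^esub> (y \<ominus>\<^bsub>?P\<^esub> z) = z \<ominus>\<^bsub>?P\<^esub> y"
      using yz by (simp add: a_minus_def P.M.minus_add P.M.minus_minus P.M.a_comm)
    then have "z \<ominus>\<^bsub>?P\<^esub> y \<in> D" using neg_D[OF 1] by simp
    then show "\<pi> y = \<pi> z" using sub 1 yz by blast
  qed
  then obtain f where f: "f \<in> rhom (carrier C) ?P (power_act n za) Z za"
    "\<And>d. d \<in> D \<Longrightarrow> f d = \<zero>\<^bsub>Z\<^esub>" "f x \<noteq> \<zero>\<^bsub>Z\<^esub>"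
    using cogenerator_separates[OF cogen P.right_module_axioms Z D, where \<pi> = \<pi> and x = x] x
    by blast
  obtain c where "\<And>i. i < n \<Longrightarrow> c i \<in> carrier C"
    "\<And>x. x \<in> carrier ?P \<Longrightarrow> f x = (\<Oplus>\<^bsub>Z\<^esub>i\<in>{..<n}. za (x i) (c i))"
    using rhom_power_module[OF Z f(1) end_scalar] by blast
  with f D(1) x show ?thesis by (metis subsetD)
qed

section \<open>Weak density in the biendomorphism ring of the dual\<close>

lemma dual_simps:
  "carrier (dual C U ra Z za) = rhom (carrier C) U ra Z za"
  "\<rho> \<oplus>\<^bsub>dual C U ra Z za\<^esub> \<sigma> = (\<lambda>u\<in>carrier U. \<rho> u \<oplus>\<^bsub>Z\<^esub> \<sigma> u)"
  unfolding dual_def by auto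

lemma dual_add_closed:
  assumes "right_module C U ra" and "right_module C Z za"
    and \<rho>: "\<rho> \<in> carrier (dual C U ra Z za)" and \<sigma>: "\<sigma> \<in> carrier (dual C U ra Z za)"
  shows "\<rho> \<oplus>\<^bsub>dual C U ra Z za\<^esub> \<sigma> \<in> carrier (dual C U ra Z za)"
proof -
  interpret U: right_module C U ra by fact
  interpret Z: right_module C Z za by fact
  show ?thesis
    using rhomD(1-3)[OF \<rho>[unfolded dual_simps]] rhomD(1-3)[OF \<sigma>[unfolded dual_simps]]
    unfolding dual_simps by (auto simp: rhom_def Z.act_l_distr U.act_closed Z.M.a_ac)
qed

lemma dual_act_closed:
  assumes "bimodule R C U la ra"
    and \<rho>: "\<rho> \<in> carrier (dual C U ra Z za)" and r: "r \<in> carrier R"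
  shows "dual_act U la \<rho> r \<in> carrier (dual C U ra Z za)"
proof -
  interpret bimodule R C U la ra by fact
  show ?thesis
    using rhomD(1-3)[OF \<rho>[unfolded dual_simps]] r
    unfolding dual_simps
    by (auto simp: rhom_def dual_act_def bi_assoc left.act_r_distr left.act_closed right.act_closed)
qed

section \<open>Biendomorphisms of the dual under finite sums and precomposition\<close>

text \<open>Additivity of \<open>s\<close> is available only between members of the dual, so
  membership of the partial sums is carried through the induction together with the formula. Sums
  are formed pointwise in Z.\<close>

lemma rbiend_sum:
  fixes n :: nat
  assumes "right_module C U ra" and "right_module C Z za"
    and s: "s \<in> rbiend R (dual C U ra Z za) act"
    and \<theta>: "\<And>i. i < n \<Longrightarrow> \<theta> i \<in> carrier (dual C U ra Z za)"
  shows "(\<lambda>u\<in>carrier U. \<Oplus>\<^bsub>Z\<^esub>i\<in>{..<n}. \<theta> i u) \<in> carrier (dual C U ra Z za) \<and>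
    (\<forall>u\<in>carrier U. s (\<lambda>u\<in>carrier U. \<Oplus>\<^bsub>Z\<^esub>i\<in>{..<n}. \<theta> i u) u = (\<Oplus>\<^bsub>Z\<^esub>i\<in>{..<n}. s (\<theta> i) u))"
proof -
  interpret U: right_module C U ra by fact
  interpret Z: right_module C Z za by fact
  let ?D = "dual C U ra Z za"
  note s' = lhomD[OF s[unfolded rbiend_def]]
  have val: "\<rho> u \<in> carrier Z" if "\<rho> \<in> carrier ?D" "u \<in> carrier U" for \<rho> u
    using that by (auto simp: dual_simps dest: rhomD)
  show ?thesis
    using \<theta>
  proof (induction n)
    case 0
    \<comment> \<open>The empty sum is the zero functional. From z + z = z the image
      \<open>s z\<close> also equals its double, and cancellation takes place in Z after
      evaluation.\<close>
    define z where "z = (\<lambda>u\<in>carrier U. \<zero>\<^bsub>Z\<^esub>)"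
    have z: "z \<in> carrier ?D"
      unfolding dual_simps z_def by (auto simp: rhom_def Z.act_zero U.act_closed)
    have "z \<oplus>\<^bsub>?D\<^esub> z = z" by (auto simp: dual_simps z_def)
    then have double: "s z \<oplus>\<^bsub>?D\<^esub> s z = s z" using s'(2)[OF z z] by simp
    have s_zero: "s z u = \<zero>\<^bsub>Z\<^esub>" if "u \<in> carrier U" for u
    proof -
      have "s z u \<oplus>\<^bsub>Z\<^esub> s z u = (s z \<oplus>\<^bsub>?D\<^esub> s z) u"
        using that by (simp add: dual_simps)
      then show ?thesis
        using double that val[OF s'(1)[OF z]] Z.M.zero_if_double by metis
    qed
    have "(\<lambda>u\<in>carrier U. \<Oplus>\<^bsub>Z\<^esub>i\<in>{..<0}. \<theta> i u) = z"
      unfolding z_def by (rule ext) simp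
    then show ?case using z s_zero by (simp del: lessThan_0) simp
  next
    case (Suc n)
    let ?S = "\<lambda>u\<in>carrier U. \<Oplus>\<^bsub>Z\<^esub>i\<in>{..<n}. \<theta> i u"
    have IH: "?S \<in> carrier ?D" "\<And>u. u \<in> carrier U \<Longrightarrow> s ?S u = (\<Oplus>\<^bsub>Z\<^esub>i\<in>{..<n}. s (\<theta> i) u)"
      using Suc.IH[OF Suc.prems[OF less_SucI]] by blast+
    have \<theta>n: "\<theta> n \<in> carrier ?D" using Suc.prems by simp
    have eq: "(\<lambda>u\<in>carrier U. \<Oplus>\<^bsub>Z\<^esub>i\<in>{..<Suc n}. \<theta> i u) = ?S \<oplus>\<^bsub>?D\<^esub> \<theta> n"
      unfolding dual_simps using Suc.prems val
      by (intro ext) (simp add: Z.M.finsum_lessThan_Suc del: lessThan_Suc)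
    have "s (?S \<oplus>\<^bsub>?D\<^esub> \<theta> n) u = (\<Oplus>\<^bsub>Z\<^esub>i\<in>{..<Suc n}. s (\<theta> i) u)" if u: "u \<in> carrier U" for u
    proof -
      have "s (?S \<oplus>\<^bsub>?D\<^esub> \<theta> n) u = s ?S u \<oplus>\<^bsub>Z\<^esub> s (\<theta> n) u"
        using s'(2)[OF IH(1) \<theta>n] u by (simp add: dual_simps)
      then show ?thesis
        using IH(2)[OF u] val[OF s'(1)] u Suc.prems
        by (simp add: Z.M.finsum_lessThan_Suc del: lessThan_Suc)
    qed
    then show ?case
      unfolding eq using dual_add_closed[OF assms(1,2) IH(1) \<theta>n] by blast
  qed
qed

text \<open>Precomposition with \<phi> is an R-endomorphism of the dual because \<phi> commutes with
  R, so \<open>s\<close> commutes with it. Commutation of \<phi> with C keeps the composite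
  C-linear.\<close>

lemma rbiend_precompose:
  assumes "bimodule R C U la ra" and "right_module C Z za"
    and s: "s \<in> rbiend R (dual C U ra Z za) (dual_act U la)"
    and \<phi>: "\<phi> \<in> lhom (carrier R) U la U la"
    and \<phi>_C: "\<And>u c. \<lbrakk>u \<in> carrier U; c \<in> carrier C\<rbrakk> \<Longrightarrow> \<phi> (ra u c) = ra (\<phi> u) c"
    and \<rho>: "\<rho> \<in> carrier (dual C U ra Z za)"
  shows "(\<lambda>u\<in>carrier U. \<rho> (\<phi> u)) \<in> carrier (dual C U ra Z za)"
    and "u \<in> carrier U \<Longrightarrow> s (\<lambda>u\<in>carrier U. \<rho> (\<phi> u)) u = s \<rho> (\<phi> u)"
proof -
  interpret bimodule R C U la ra by fact
  let ?D = "dual C U ra Z za"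
  \<comment> \<open>Precomposition as an extensional map on the dual, the form in which the
    definition of \<open>rbiend\<close> accepts it.\<close>
  define E where "E = (\<lambda>\<rho>\<in>carrier ?D. \<lambda>u\<in>carrier U. \<rho> (\<phi> u))"
  note \<phi>' = lhomD[OF \<phi>]
  note s' = lhomD[OF s[unfolded rbiend_def]]
  have cl: "(\<lambda>u\<in>carrier U. \<rho> (\<phi> u)) \<in> carrier ?D" if "\<rho> \<in> carrier ?D" for \<rho>
    using rhomD(1-3)[OF that[unfolded dual_simps]] \<phi>' \<phi>_C unfolding dual_simps
    by (auto simp: rhom_def right.act_closed)
  then show "(\<lambda>u\<in>carrier U. \<rho> (\<phi> u)) \<in> carrier ?D" using \<rho> by blast
  have "E (\<rho> \<oplus>\<^bsub>?D\<^esub> \<sigma>) = E \<rho> \<oplus>\<^bsub>?D\<^esub> E \<sigma>" if "\<rho> \<in> carrier ?D" "\<sigma> \<in> carrier ?D" for \<rho> \<sigma>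
    using that \<phi>'(1) dual_add_closed[OF right.right_module_axioms assms(2) that]
    by (auto simp: E_def dual_simps(2))
  moreover have "E (dual_act U la \<rho> r) = dual_act U la (E \<rho>) r"
    if "\<rho> \<in> carrier ?D" "r \<in> carrier R" for \<rho> r
    using that \<phi>'(1,3) dual_act_closed[OF assms(1) that] left.act_closed
    by (auto simp: E_def dual_act_def)
  ultimately have "E \<in> rhom (carrier R) ?D (dual_act U la) ?D (dual_act U la)"
    using cl unfolding rhom_def by (auto simp: E_def)
  from s'(3)[OF this \<rho>] have "s (\<lambda>u\<in>carrier U. \<rho> (\<phi> u)) = (\<lambda>u\<in>carrier U. s \<rho> (\<phi> u))"
    using \<rho> s'(1)[OF \<rho>] by (simp add: E_def)
  then show "s (\<lambda>u\<in>carrier U. \<rho> (\<phi> u)) u = s \<rho> (\<phi> u)" if "u \<in> carrier U"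
    using that by simp
qed

text \<open>Taking r = f(u) in \<open>vanish\<close> shows that the functionals sending u to
  \<rho>_i(f(u) w_i) add up to zero. Applying \<open>s\<close> and evaluating at v gives the claim
  for t = f(v), and sums of such values give all of the trace ideal.\<close>

lemma rbiend_sum_vanishes:
  fixes R :: "('r, 'p) ring_scheme" and C :: "('c, 'q) ring_scheme"
    and U :: "('u, 's) ring_scheme" and Z :: "('z, 't) ring_scheme" and n :: nat
  assumes bi: "bimodule R C U la ra" and Z: "right_module C Z za"
    and \<iota>: "\<iota> \<in> carrier C \<rightarrow> carrier R" "\<And>c u. \<lbrakk>c \<in> carrier C; u \<in> carrier U\<rbrakk> \<Longrightarrow> la (\<iota> c) u = ra u c"
    and s: "s \<in> rbiend R (dual C U ra Z za) (dual_act U la)"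
    and \<rho>: "\<And>i. i < n \<Longrightarrow> \<rho> i \<in> carrier (dual C U ra Z za)"
    and w: "\<And>i. i < n \<Longrightarrow> w i \<in> carrier U"
    and vanish: "\<And>r. r \<in> carrier R \<Longrightarrow> (\<Oplus>\<^bsub>Z\<^esub>i\<in>{..<n}. \<rho> i (la r (w i))) = \<zero>\<^bsub>Z\<^esub>"
    and t: "t \<in> trace_ideal R U la"
  shows "(\<Oplus>\<^bsub>Z\<^esub>i\<in>{..<n}. s (\<rho> i) (la t (w i))) = \<zero>\<^bsub>Z\<^esub>"
proof -
  interpret bimodule R C U la ra by fact
  interpret Z: right_module C Z za by fact
  let ?D = "dual C U ra Z za"
  have sD: "s \<sigma> \<in> rhom (carrier C) U ra Z za" if "\<sigma> \<in> carrier ?D" for \<sigma>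
    using lhomD(1)[OF s[unfolded rbiend_def] that] unfolding dual_simps .
  have s\<rho>: "s (\<rho> i) \<in> rhom (carrier C) U ra Z za" if "i < n" for i
    using sD \<rho> that by blast
  show ?thesis
    using t left.R.ring_axioms
  proof (induction rule: trace_ideal_induct)
    case zero
    have "(\<Oplus>\<^bsub>Z\<^esub>i\<in>{..<n}. s (\<rho> i) (la \<zero>\<^bsub>R\<^esub> (w i))) = (\<Oplus>\<^bsub>Z\<^esub>i\<in>{..<n}. \<zero>\<^bsub>Z\<^esub>)"
      using w rhom_zero[OF s\<rho> left.M.abelian_group_axioms Z.M.abelian_group_axioms]
      by (intro Z.M.finsum_cong') (auto simp: left.act_zero_scalar)
    then show ?case by simp
  next
    case (add t f v)
    note f = lhomD[OF add.hyps(2)]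
    let ?\<theta> = "\<lambda>i::nat. \<lambda>u\<in>carrier U. \<rho> i (la (f u) (w i))"
    have \<theta>: "?\<theta> i \<in> carrier ?D" "s (?\<theta> i) v = s (\<rho> i) (la (f v) (w i))" if i: "i < n" for i
    proof -
      let ?\<phi> = "\<lambda>x\<in>carrier U. la (f x) (w i)"
      have \<phi>: "?\<phi> \<in> lhom (carrier R) U la U la"
        by (rule lhom_mult_endo[OF left.left_module_axioms add.hyps(2) w[OF i]])
      \<comment> \<open>An R-endomorphism is automatically C-linear here, since each c acts on U as
        the element \<open>\<iota> c\<close> of R.\<close>
      have \<phi>_C: "?\<phi> (ra u c) = ra (?\<phi> u) c" if "u \<in> carrier U" "c \<in> carrier C" for u c
      proof -
        have "\<iota> c \<in> carrier R" "la (\<iota> c) u = ra u c"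
          using that \<iota> by auto
        then show ?thesis
          using lhomD(3)[OF \<phi>, of "\<iota> c" u] \<iota>(2)[OF that(2) lhomD(1)[OF \<phi> that(1)]] that by simp
      qed
      have eq: "(\<lambda>u\<in>carrier U. \<rho> i (?\<phi> u)) = ?\<theta> i" by auto
      show "?\<theta> i \<in> carrier ?D" "s (?\<theta> i) v = s (\<rho> i) (la (f v) (w i))"
        using rbiend_precompose[OF bi Z s \<phi> \<phi>_C \<rho>[OF i], unfolded eq] add.hyps(3) by auto
    qed
    let ?S = "\<lambda>u\<in>carrier U. \<Oplus>\<^bsub>Z\<^esub>i\<in>{..<n}. ?\<theta> i u"
    let ?O = "\<lambda>u\<in>carrier U. \<zero>\<^bsub>Z\<^esub>"
    have "?S = ?O"
      using vanish f(1) by auto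
    \<comment> \<open>The zero functional is also written as an empty sum, so that
      \<open>rbiend_sum\<close> with length 0 yields that \<open>s\<close> sends it to zero.\<close>
    moreover have "(\<lambda>u\<in>carrier U. \<Oplus>\<^bsub>Z\<^esub>i\<in>{..<0::nat}. ?\<theta> i u) = ?O"
      by simp
    ultimately have "(\<Oplus>\<^bsub>Z\<^esub>i\<in>{..<n}. s (?\<theta> i) v) = \<zero>\<^bsub>Z\<^esub>"
      using rbiend_sum[OF right.right_module_axioms Z s, of n ?\<theta>] \<theta>(1)
        rbiend_sum[OF right.right_module_axioms Z s, of 0 ?\<theta>] add.hyps(3) by simp
    moreover have "(\<Oplus>\<^bsub>Z\<^esub>i\<in>{..<n}. s (?\<theta> i) v) = (\<Oplus>\<^bsub>Z\<^esub>i\<in>{..<n}. s (\<rho> i) (la (f v) (w i)))"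
      using \<theta>(2) rhomD(1)[OF s\<rho>] w f(1) add.hyps(3) left.act_closed
      by (intro Z.M.finsum_cong') auto
    ultimately have fv: "(\<Oplus>\<^bsub>Z\<^esub>i\<in>{..<n}. s (\<rho> i) (la (f v) (w i))) = \<zero>\<^bsub>Z\<^esub>" by simp
    have "(\<Oplus>\<^bsub>Z\<^esub>i\<in>{..<n}. s (\<rho> i) (la (t \<oplus>\<^bsub>R\<^esub> f v) (w i)))
      = (\<Oplus>\<^bsub>Z\<^esub>i\<in>{..<n}. s (\<rho> i) (la t (w i)) \<oplus>\<^bsub>Z\<^esub> s (\<rho> i) (la (f v) (w i)))"
      using rhomD(1,2)[OF s\<rho>] w f(1) add.hyps(1,3) left.act_closed left.act_l_distr
      by (intro Z.M.finsum_cong') auto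
    also have "\<dots> = (\<Oplus>\<^bsub>Z\<^esub>i\<in>{..<n}. s (\<rho> i) (la t (w i)))
        \<oplus>\<^bsub>Z\<^esub> (\<Oplus>\<^bsub>Z\<^esub>i\<in>{..<n}. s (\<rho> i) (la (f v) (w i)))"
      using rhomD(1)[OF s\<rho>] w f(1) add.hyps(1,3) left.act_closed
      by (intro Z.M.finsum_addf) auto
    finally show ?case using fv add.IH by simp
  qed
qed

lemma rbiend_weakly_dense:
  fixes R :: "('r, 'p) ring_scheme" and C :: "('c, 'q) ring_scheme"
    and U :: "('u, 's) ring_scheme" and Z :: "('z, 't) ring_scheme"
  assumes bi: "bimodule R C U la ra" and Z: "right_module C Z za"
    and cogen: "cogenerator TYPE(('c, 'z) univ) C Z za"
    and end_scalar: "\<forall>f\<in>rhom (carrier C) Z za Z za. \<exists>c\<in>carrier C. \<forall>z\<in>carrier Z. f z = za z c"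
    and \<iota>: "\<iota> \<in> carrier C \<rightarrow> carrier R" "\<And>c u. \<lbrakk>c \<in> carrier C; u \<in> carrier U\<rbrakk> \<Longrightarrow> la (\<iota> c) u = ra u c"
    and fixes_tuples: "\<And>n u. u \<in> tuples n U \<Longrightarrow> u \<in> set_act_tuple la (trace_ideal R U la) n u"
    and s: "s \<in> rbiend R (dual C U ra Z za) (dual_act U la)"
    and H: "finite H" "H \<subseteq> carrier U \<times> carrier (dual C U ra Z za)"
  shows "\<exists>r\<in>carrier R. \<forall>(u, \<rho>)\<in>H. dual_act U la \<rho> r u = s \<rho> u"
proof -
  interpret bimodule R C U la ra by fact
  interpret Z: right_module C Z za by fact
  let ?D = "dual C U ra Z za" and ?hom = "rhom (carrier C) U ra Z za"
  obtain n :: nat and h where h: "H = h ` {..<n}"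
    by (rule finite_enumerate[OF H(1)])
  define u where "u i = fst (h i)" for i
  define \<rho> where "\<rho> i = snd (h i)" for i
  have H_eq: "H = (\<lambda>i. (u i, \<rho> i)) ` {..<n}"
    unfolding h u_def \<rho>_def by simp
  have u: "u i \<in> carrier U" and \<rho>D: "\<rho> i \<in> carrier ?D" if "i < n" for i
    using that H(2) unfolding H_eq by auto
  have \<rho>: "\<rho> i \<in> ?hom" and s\<rho>: "s (\<rho> i) \<in> ?hom" if "i < n" for i
    using \<rho>D[OF that] lhomD(1)[OF s[unfolded rbiend_def]] unfolding dual_simps by auto
  \<comment> \<open>\<open>x\<close> is the tuple to be attained and \<open>d r\<close> the one
    attained by \<open>r\<close>; the goal becomes that \<open>x\<close> lies in the range
    \<open>D\<close> of \<open>d\<close>.\<close>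
  define x where "x = (\<lambda>i\<in>{..<n}. s (\<rho> i) (u i))"
  define d where "d r = (\<lambda>i\<in>{..<n}. \<rho> i (la r (u i)))" for r
  define D where "D = d ` carrier R"
  have x: "x \<in> carrier (power_module n Z)"
    using u rhomD(1)[OF s\<rho>] by (auto simp: x_def power_module_simps)
  have "x \<in> D"
  proof (rule ccontr)
    assume "x \<notin> D"
    have D_sub: "D \<subseteq> carrier (power_module n Z)"
      using u rhomD(1)[OF \<rho>] left.act_closed by (auto simp: D_def d_def power_module_simps split: if_splits)
    have d_add: "d r \<oplus>\<^bsub>power_module n Z\<^esub> d r' = d (r \<oplus>\<^bsub>R\<^esub> r')"
      if "r \<in> carrier R" "r' \<in> carrier R" for r r'
      using that u rhomD(2)[OF \<rho>] left.act_closed left.act_l_distr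
      by (auto simp: d_def power_module_simps)
    \<comment> \<open>Linearity of \<open>\<rho> i\<close> moves c into the argument, where it acts
      as \<open>\<iota> c\<close>. Hence a C-multiple of an attained tuple is attained, and
      \<open>D\<close> is a C-submodule.\<close>
    have d_act: "power_act n za (d r) c = d (\<iota> c \<otimes>\<^bsub>R\<^esub> r)"
      if "r \<in> carrier R" "c \<in> carrier C" for r c
    proof -
      have "za (\<rho> i (la r (u i))) c = \<rho> i (la (\<iota> c \<otimes>\<^bsub>R\<^esub> r) (u i))" if i: "i < n" for i
      proof -
        have "la r (u i) \<in> carrier U" "\<iota> c \<in> carrier R"
          using left.act_closed u[OF i] \<iota>(1) \<open>r \<in> carrier R\<close> \<open>c \<in> carrier C\<close> by auto
        then show ?thesis
          using rhomD(3)[OF \<rho>[OF i], of c "la r (u i)"] \<iota>(2)[of c "la r (u i)"] left.act_assoc u[OF i]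
            \<open>r \<in> carrier R\<close> \<open>c \<in> carrier C\<close> by simp
      qed
      then show ?thesis by (auto simp: d_def power_act_def)
    qed
    interpret P: right_module C "power_module n Z" "power_act n za"
      by (rule right_module_power[OF Z])
    have d0: "d \<zero>\<^bsub>R\<^esub> = \<zero>\<^bsub>power_module n Z\<^esub>"
      using d_add[of "\<zero>\<^bsub>R\<^esub>" "\<zero>\<^bsub>R\<^esub>"] D_sub by (intro P.M.zero_if_double) (auto simp: D_def)
    have "\<exists>c. (\<forall>i<n. c i \<in> carrier C) \<and>
      (\<forall>y\<in>D. (\<Oplus>\<^bsub>Z\<^esub>i\<in>{..<n}. za (y i) (c i)) = \<zero>\<^bsub>Z\<^esub>) \<and>
      (\<Oplus>\<^bsub>Z\<^esub>i\<in>{..<n}. za (x i) (c i)) \<noteq> \<zero>\<^bsub>Z\<^esub>"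
    proof (rule cogenerator_separates_power[OF cogen Z end_scalar D_sub _ _ _ x \<open>x \<notin> D\<close>])
      show "\<zero>\<^bsub>power_module n Z\<^esub> \<in> D"
        unfolding D_def using d0 by (intro image_eqI[of _ _ "\<zero>\<^bsub>R\<^esub>"]) auto
      show "y \<oplus>\<^bsub>power_module n Z\<^esub> z \<in> D" if "y \<in> D" "z \<in> D" for y z
        using that d_add unfolding D_def by auto
      show "power_act n za y c \<in> D" if "y \<in> D" "c \<in> carrier C" for y c
        using that d_act \<iota>(1) unfolding D_def by (auto intro!: imageI left.R.m_closed)
    qed
    then obtain c where c: "\<And>i. i < n \<Longrightarrow> c i \<in> carrier C"
      "\<And>y. y \<in> D \<Longrightarrow> (\<Oplus>\<^bsub>Z\<^esub>i\<in>{..<n}. za (y i) (c i)) = \<zero>\<^bsub>Z\<^esub>"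
      "(\<Oplus>\<^bsub>Z\<^esub>i\<in>{..<n}. za (x i) (c i)) \<noteq> \<zero>\<^bsub>Z\<^esub>"
      by blast
    \<comment> \<open>The separating scalars are absorbed into the arguments, turning the weighted
      sums over \<open>D\<close> and \<open>x\<close> into plain sums of functionals at
      \<open>w i\<close>.\<close>
    define w where "w i = ra (u i) (c i)" for i
    have w: "w i \<in> carrier U" if "i < n" for i
      using that u c(1) right.act_closed unfolding w_def by blast
    obtain t where t: "t \<in> trace_ideal R U la" "\<And>i. i < n \<Longrightarrow> la t (w i) = w i"
      using trace_ideal_fixes[where u = w, OF fixes_tuples w] by auto
    have "(\<Oplus>\<^bsub>Z\<^esub>i\<in>{..<n}. \<rho> i (la r (w i))) = \<zero>\<^bsub>Z\<^esub>" if r: "r \<in> carrier R" for r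
    proof -
      have "(\<Oplus>\<^bsub>Z\<^esub>i\<in>{..<n}. \<rho> i (la r (w i))) = (\<Oplus>\<^bsub>Z\<^esub>i\<in>{..<n}. za (d r i) (c i))"
        using r u c(1) rhomD(1,3)[OF \<rho>] left.act_closed Z.act_closed
        by (intro Z.M.finsum_cong') (auto simp: d_def w_def bi_assoc)
      then show ?thesis using c(2) r unfolding D_def by simp
    qed
    from rbiend_sum_vanishes[OF bi Z \<iota> s \<rho>D w this t(1)]
    have "(\<Oplus>\<^bsub>Z\<^esub>i\<in>{..<n}. s (\<rho> i) (la t (w i))) = \<zero>\<^bsub>Z\<^esub>" by simp
    \<comment> \<open>As \<open>t\<close> fixes \<open>w i\<close> and \<open>s (\<rho> i)\<close>
      is C-linear, this is the weighted sum that the choice of \<open>c\<close> keeps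
      nonzero.\<close>
    moreover have "(\<Oplus>\<^bsub>Z\<^esub>i\<in>{..<n}. s (\<rho> i) (la t (w i))) = (\<Oplus>\<^bsub>Z\<^esub>i\<in>{..<n}. za (x i) (c i))"
      using t(2) u c(1) rhomD(1,3)[OF s\<rho>] Z.act_closed
      by (intro Z.M.finsum_cong') (auto simp: x_def w_def)
    ultimately show False using c(3) by simp
  qed
  then obtain r where r: "r \<in> carrier R" "x = d r" unfolding D_def by auto
  have "\<rho> i (la r (u i)) = s (\<rho> i) (u i)" if "i < n" for i
    using fun_cong[OF r(2), of i] that unfolding x_def d_def by simp
  then show ?thesis
    using r(1) u unfolding H_eq by (intro bexI[of _ r]) (auto simp: dual_act_def)
qed

section \<open>Both density statements for the bimodule U\<close>

theorem proposition5p1: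
  fixes R :: "('r, 'p) ring_scheme" and C :: "('c, 'q) ring_scheme"
    and U :: "('u, 's) ring_scheme" and la :: "'r \<Rightarrow> 'u \<Rightarrow> 'u" and ra :: "'u \<Rightarrow> 'c \<Rightarrow> 'u"
    and Z :: "('z, 't) ring_scheme" and za :: "'z \<Rightarrow> 'c \<Rightarrow> 'z"
  assumes "ring R" and "ring C"
    and "right_module C Z za"
    and "injective TYPE(('c, 'z) univ) C Z za"
    and "cogenerator TYPE(('c, 'z) univ) C Z za"
    and "bimodule R C U la ra"
    and "faithful R U la"
    and "\<And>n u. u \<in> tuples n U \<Longrightarrow> u \<in> set_act_tuple la (trace_ideal R U la) n u"
  shows
    "(\<forall>b\<in>lbiend R U la. \<forall>G. finite G \<and> G \<subseteq> carrier U \<longrightarrow>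
        (\<exists>r\<in>carrier R. \<forall>u\<in>G. la r u = b u))
     \<and>
     (\<forall>\<iota>. \<iota> \<in> ring_hom C R \<and> inj_on \<iota> (carrier C) \<and> \<iota> ` carrier C \<subseteq> ring_center R \<and>
        (\<forall>c\<in>carrier C. \<forall>u\<in>carrier U. la (\<iota> c) u = ra u c) \<and>
        torsionless R U la \<and> flat TYPE(('r, 'u) univ) R U la \<and>
        (\<forall>f\<in>rhom (carrier C) Z za Z za. \<exists>c\<in>carrier C. \<forall>z\<in>carrier Z. f z = za z c)
      \<longrightarrow>
        (\<forall>s\<in>rbiend R (dual C U ra Z za) (dual_act U la).
          \<forall>H. finite H \<and> H \<subseteq> carrier U \<times> carrier (dual C U ra Z za) \<longrightarrow>
            (\<exists>r\<in>carrier R. \<forall>(u, \<rho>)\<in>H. dual_act U la \<rho> r u = s \<rho> u)))"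
proof (intro conjI ballI allI impI)
  interpret bimodule R C U la ra by fact
  fix b G assume "b \<in> lbiend R U la" "finite G \<and> G \<subseteq> carrier U"
  then show "\<exists>r\<in>carrier R. \<forall>u\<in>G. la r u = b u"
    using lbiend_dense[OF left.left_module_axioms assms(8)] by blast
next
  fix \<iota> s and H :: "('u \<times> ('u \<Rightarrow> 'z)) set"
  assume "\<iota> \<in> ring_hom C R \<and> inj_on \<iota> (carrier C) \<and> \<iota> ` carrier C \<subseteq> ring_center R \<and>
      (\<forall>c\<in>carrier C. \<forall>u\<in>carrier U. la (\<iota> c) u = ra u c) \<and>
      torsionless R U la \<and> flat TYPE(('r, 'u) univ) R U la \<and>
      (\<forall>f\<in>rhom (carrier C) Z za Z za. \<exists>c\<in>carrier C. \<forall>z\<in>carrier Z. f z = za z c)"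
    and s: "s \<in> rbiend R (dual C U ra Z za) (dual_act U la)"
    and H: "finite H \<and> H \<subseteq> carrier U \<times> carrier (dual C U ra Z za)"
  then have "\<iota> \<in> carrier C \<rightarrow> carrier R" "\<And>c u. \<lbrakk>c \<in> carrier C; u \<in> carrier U\<rbrakk> \<Longrightarrow> la (\<iota> c) u = ra u c"
    "\<forall>f\<in>rhom (carrier C) Z za Z za. \<exists>c\<in>carrier C. \<forall>z\<in>carrier Z. f z = za z c"
    by (auto simp: ring_hom_def)
  from rbiend_weakly_dense[OF assms(6,3,5) this(3,1,2) assms(8) s] H
  show "\<exists>r\<in>carrier R. \<forall>(u, \<rho>)\<in>H. dual_act U la \<rho> r u = s \<rho> u"
    by blast
qed

end
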